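(* For every $d\ge 1$ there is no set $\Lambda\subseteq\mathbb{C}^d$ that is simultaneously a set of sampling and a set of interpolation for the Bargmann–Fock space $\mathcal{F}^2(\mathbb{C}^d)$.
   Context: $\mathcal{F}^2(\mathbb{C}^d)$ is the Hilbert space of entire functions $F$ on $\mathbb{C}^d$ with $\|F\|_{\mathcal{F}}^2=\int_{\mathbb{C}^d}|F(z)|^2e^{-\pi|z|^2}dz<\infty$. A set $\Lambda\subseteq\mathbb{C}^d$ is a set of sampling if there are constants $0<A\le B$ with $A\|F\|_{\mathcal{F}}^2\le\sum_{\lambda\in\Lambda}|F(\lambda)|^2e^{-\pi|\lambda|^2}\le B\|F\|_{\mathcal{F}}^2$ for all $F\in\mathcal{F}^2$, and a set of interpolation if for every $(c_\lambda)\in\ell^2(\Lambda)$ there exists $F\in\mathcal{F}^2$ with $F(\lambda)e^{-\pi|\lambda|^2/2}=c_\lambda$ for all $\lambda\in\Lambda$. *)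

theory Defs
  imports "HOL-Analysis.Analysis"
begin

text \<open>C^d is modelled as complex^'n for a finite index type 'n (so d = CARD('n) >= 1).
Lebesgue measure on C^d = R^(2d) is lborel on this euclidean space; |z| is the Euclidean norm.\<close>

definition entire_Cd :: "(complex ^ 'n::finite \<Rightarrow> complex) \<Rightarrow> bool" where
  "entire_Cd F \<longleftrightarrow> (\<forall>z. \<exists>L. (F has_derivative L) (at z) \<and>
       (\<forall>c v. L (c *s v) = c * L v))"

definition fock_weight_fun :: "(complex ^ 'n::finite \<Rightarrow> complex) \<Rightarrow> complex ^ 'n \<Rightarrow> real" where
  "fock_weight_fun F z = (cmod (F z))\<^sup>2 * exp (- pi * (norm z)\<^sup>2)"

definition fock_space :: "(complex ^ 'n::finite \<Rightarrow> complex) set" where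
  "fock_space = {F. entire_Cd F \<and> integrable lborel (fock_weight_fun F)}"

definition fock_norm2 :: "(complex ^ 'n::finite \<Rightarrow> complex) \<Rightarrow> real" where
  "fock_norm2 F = (\<integral>z. fock_weight_fun F z \<partial>lborel)"

definition sampling_set :: "(complex ^ 'n::finite) set \<Rightarrow> bool" where
  "sampling_set \<Lambda> \<longleftrightarrow> (\<exists>A B. 0 < A \<and> A \<le> B \<and>
     (\<forall>F \<in> (fock_space :: (complex ^ 'n \<Rightarrow> complex) set).
        fock_weight_fun F summable_on \<Lambda> \<and>
        A * fock_norm2 F \<le> (\<Sum>\<^sub>\<infinity>w\<in>\<Lambda>. fock_weight_fun F w) \<and>
        (\<Sum>\<^sub>\<infinity>w\<in>\<Lambda>. fock_weight_fun F w) \<le> B * fock_norm2 F))"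

definition interpolating_set :: "(complex ^ 'n::finite) set \<Rightarrow> bool" where
  "interpolating_set \<Lambda> \<longleftrightarrow> (\<forall>c :: complex ^ 'n \<Rightarrow> complex.
     (\<lambda>w. (cmod (c w))\<^sup>2) summable_on \<Lambda> \<longrightarrow>
     (\<exists>F \<in> fock_space. \<forall>w\<in>\<Lambda>. F w * exp (- pi * (norm w)\<^sup>2 / 2) = c w))"

end

theory Submission
  imports Defs "HOL-Complex_Analysis.Cauchy_Integral_Formula" "HOL-Probability.Distributions"
begin

text \<open>Let \<open>F\<close> interpolate the delta function at \<open>p \<in> \<Lambda>\<close>. The entire function
  \<open>H z = (z\<^sub>k - p\<^sub>k) F z\<close> vanishes on \<open>\<Lambda>\<close> and misses the Fock space by at most one power of \<open>|z|\<close>.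
  Smooth it with the resolvent of the Euler operator: the average \<open>G\<close> of the dilates \<open>H (r z)\<close> with
  density \<open>N r\<^bsup>N-1\<^esup>\<close> lies in the Fock space and satisfies \<open>N H = N G + \<Sum>\<^sub>j z\<^sub>j \<partial>\<^sub>j G\<close>. Hence on
  \<open>\<Lambda>\<close>, with the covariant derivatives \<open>D\<^sub>j = \<partial>\<^sub>j - \<pi> cnj z\<^sub>j\<close>,
  \<open>(N + \<pi> |z|\<^sup>2) G = - \<Sum>\<^sub>j z\<^sub>j D\<^sub>j G\<close>, so \<open>|G|\<^sup>2 \<le> (1 / N) \<Sum>\<^sub>j |D\<^sub>j G|\<^sup>2\<close> there. The upper sampling bound
  controls the weighted sums of the \<open>|D\<^sub>j G|\<^sup>2\<close> over \<open>\<Lambda>\<close> by a constant times the squared norm of \<open>G\<close>,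
  and for large \<open>N\<close> the lower sampling bound forces \<open>G = 0\<close>. Then \<open>H = 0\<close> and \<open>F p = 0\<close>.\<close>

section \<open>One complex variable: mean squares and Cauchy's formula\<close>

text \<open>Cauchy--Schwarz on an interval of length one: with \<open>m\<close> the modulus of the
  integral, integrate \<open>2 * m * cmod (f t) - m\<^sup>2 \<le> (cmod (f t))\<^sup>2\<close>, a
  rearranged square.\<close>

lemma integral_norm_square_le:
  fixes f :: "real \<Rightarrow> complex"
  assumes f: "continuous_on {0..1} f"
  shows "(cmod (integral {0..1} f))\<^sup>2 \<le> integral {0..1} (\<lambda>t. (cmod (f t))\<^sup>2)"
proof -
  define m where "m = cmod (integral {0..1} f)"
  have "f integrable_on {0..1}"
    using f by (rule integrable_continuous_interval)
  moreover have int: "(\<lambda>t. cmod (f t)) integrable_on {0..1}" "(\<lambda>t. (cmod (f t))\<^sup>2) integrable_on {0..1}"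
    by (intro integrable_continuous_interval continuous_intros f)+
  ultimately have m: "m \<le> integral {0..1} (\<lambda>t. cmod (f t))"
    unfolding m_def by (intro integral_norm_bound_integral) auto
  have "m\<^sup>2 \<le> 2 * m * integral {0..1} (\<lambda>t. cmod (f t)) - m\<^sup>2"
    using m by (auto simp: m_def power2_eq_square mult_left_mono)
  also have "\<dots> = integral {0..1} (\<lambda>t. 2 * m * cmod (f t) - m\<^sup>2)"
    using int by (subst integral_diff) (auto intro: integrable_on_mult_right)
  also have "\<dots> \<le> integral {0..1} (\<lambda>t. (cmod (f t))\<^sup>2)"
  proof (rule integral_le)
    show "2 * m * cmod (f t) - m\<^sup>2 \<le> (cmod (f t))\<^sup>2" for t
      using zero_le_power2[of "cmod (f t) - m"] by (simp add: power2_diff algebra_simps)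
  qed (use int in \<open>auto intro!: integrable_diff integrable_on_mult_right\<close>)
  finally show ?thesis
    by (simp add: m_def)
qed

text \<open>Cauchy's formula on the unit circle; the factor \<open>2 * pi * \<i>\<close> cancels
  against the velocity of the path. Written as a mean over \<open>{0..1}\<close>, it can be fed to
  \<open>integral_norm_square_le\<close>.\<close>

lemma deriv_as_circle_average:
  assumes f: "f holomorphic_on UNIV"
  shows "deriv f 0 = integral {0..1} (\<lambda>t. f (exp (2 * of_real pi * \<i> * of_real t)) *
           exp (- (2 * of_real pi * \<i> * of_real t)))" (is "_ = integral _ ?g")
proof -
  have "((\<lambda>u. f u / (u - 0) ^ Suc 1) has_contour_integral
          (2 * pi * \<i>) / fact 1 * (deriv ^^ 1) f 0) (circlepath 0 1)"
    using f by (intro Cauchy_has_contour_integral_higher_derivative_circlepath)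
      (auto intro: holomorphic_on_imp_continuous_on holomorphic_on_subset)
  then have I: "((\<lambda>t. f (circlepath 0 1 t) / (circlepath 0 1 t - 0) ^ Suc 1 *
        vector_derivative (circlepath 0 1) (at t within {0..1})) has_integral
      (2 * pi * \<i>) * deriv f 0) {0..1}"
    by (simp add: has_contour_integral_def)
  have alg: "a / (e - 0) ^ Suc 1 * (c * of_real 1 * e) = c * (a * inverse e)" if "e \<noteq> 0" for a c e :: complex
    using that by (simp add: field_simps)
  have eq: "f (circlepath 0 1 t) / (circlepath 0 1 t - 0) ^ Suc 1 *
        vector_derivative (circlepath 0 1) (at t within {0..1}) = (2 * pi * \<i>) * ?g t"
    if "t \<in> {0..1}" for t
  proof -
    have e: "circlepath 0 1 t = exp (2 * of_real pi * \<i> * of_real t)"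
      by (simp add: circlepath)
    have d: "vector_derivative (circlepath 0 1) (at t within {0..1}) =
        (2 * pi * \<i>) * of_real 1 * exp (2 * of_real pi * \<i> * of_real t)"
      using that by (subst vector_derivative_circlepath01) auto
    show ?thesis
      unfolding d e exp_minus by (rule alg) simp
  qed
  have cancel: "(?g has_integral i) {0..1}"
    if "((\<lambda>t. c * ?g t) has_integral c * i) {0..1}" "c \<noteq> 0" for c i
    using has_integral_mult_right[OF that(1), of "inverse c"] that(2)
    by (simp add: mult.assoc[symmetric])
  have "((\<lambda>t. (2 * pi * \<i>) * ?g t) has_integral (2 * pi * \<i>) * deriv f 0) {0..1}"
    using eq I by (rule has_integral_eq)
  then have "(?g has_integral deriv f 0) {0..1}"
    by (rule cancel) simp
  then show ?thesis
    by (rule integral_unique[symmetric])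
qed

section \<open>Entire functions on C^d and their derivatives\<close>

lemma entire_Cd_has_derivative:
  assumes "entire_Cd F"
  shows "(F has_derivative frechet_derivative F (at z)) (at z)"
  using assms unfolding entire_Cd_def
  by (metis differentiable_def frechet_derivative_works)

lemma entire_Cd_derivative_linear:
  assumes "entire_Cd F"
  shows "frechet_derivative F (at z) (c *s v) = c * frechet_derivative F (at z) v"
  using assms unfolding entire_Cd_def
  by (metis frechet_derivative_at)

lemma entire_Cd_continuous:
  assumes "entire_Cd F"
  shows "continuous_on S F"
  using entire_Cd_has_derivative[OF assms]
  by (meson continuous_at_imp_continuous_on has_derivative_continuous)

lemma vector_scalar_mult_continuous [continuous_intros]:
  fixes v :: "complex ^ 'n::finite"
  assumes "continuous_on S f"
  shows "continuous_on S (\<lambda>x. f x *s v)"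
  unfolding vector_scalar_mult_def by (intro continuous_intros assms)

lemma entire_Cd_has_field_derivative_line:
  fixes v :: "complex ^ 'n::finite"
  assumes "entire_Cd F"
  shows "((\<lambda>c. F (z + c *s v)) has_field_derivative frechet_derivative F (at (z + c *s v)) v) (at c)"
proof -
  have bl: "bounded_linear (\<lambda>c::complex. c *s v)"
    by (rule linear_conv_bounded_linear[THEN iffD1], unfold_locales)
       (auto simp: vector_scalar_mult_def vec_eq_iff algebra_simps)
  have "((\<lambda>c. z + c *s v) has_derivative (\<lambda>c. c *s v)) (at c)"
    by (auto intro!: derivative_eq_intros bounded_linear_imp_has_derivative[OF bl])
  from has_derivative_compose[OF this entire_Cd_has_derivative[OF assms]]
  moreover have "(\<lambda>x. x * frechet_derivative F (at (z + c *s v)) v) = (*) (frechet_derivative F (at (z + c *s v)) v)"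
    by (simp add: fun_eq_iff)
  ultimately show ?thesis
    by (simp add: has_field_derivative_def entire_Cd_derivative_linear[OF assms])
qed

text \<open>Cauchy's formula on the complex line through \<open>z\<close> in direction
  \<open>v\<close>. The right-hand side involves only values of \<open>F\<close>, so continuity of
  \<open>F\<close> carries over to its derivative.\<close>

lemma entire_Cd_frechet_circle:
  fixes v :: "complex ^ 'n::finite"
  assumes "entire_Cd F"
  shows "frechet_derivative F (at z) v =
    integral {0..1} (\<lambda>t. F (z + exp (2 * of_real pi * \<i> * of_real t) *s v) *
           exp (- (2 * of_real pi * \<i> * of_real t)))"
proof -
  have "(\<lambda>c. F (z + c *s v)) holomorphic_on UNIV"
    using entire_Cd_has_field_derivative_line[OF assms]
    by (auto simp: holomorphic_on_open)
  moreover have "deriv (\<lambda>c. F (z + c *s v)) 0 = frechet_derivative F (at z) v"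
    using entire_Cd_has_field_derivative_line[OF assms, of z v 0]
    by (intro DERIV_imp_deriv) (simp only: vector_smult_lzero add_0_right)
  ultimately show ?thesis
    using deriv_as_circle_average[of "\<lambda>c. F (z + c *s v)"] by (simp only:)
qed

lemma entire_Cd_derivative_continuous:
  fixes v :: "complex ^ 'n::finite"
  assumes "entire_Cd F"
  shows "continuous_on S (\<lambda>z. frechet_derivative F (at z) v)"
proof -
  have "continuous_on S (\<lambda>z. integral (cbox 0 1)
      (\<lambda>t. F (z + exp (2 * of_real pi * \<i> * of_real t) *s v) * exp (- (2 * of_real pi * \<i> * of_real t))))"
    by (intro integral_continuous_on_param) (auto simp: split_beta intro!: continuous_intros
        continuous_on_compose2[OF entire_Cd_continuous[OF assms, of UNIV]])
  then show ?thesis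
    by (simp add: entire_Cd_frechet_circle[OF assms])
qed

section \<open>Radial means and the Euler identity\<close>

text \<open>On monomials of degree \<open>k\<close> this is multiplication by \<open>N / (N + k)\<close>, so it is the
  resolvent of the Euler operator.\<close>

definition radial_mean :: "nat \<Rightarrow> (complex ^ 'n::finite \<Rightarrow> complex) \<Rightarrow> complex ^ 'n \<Rightarrow> complex" where
  "radial_mean N H z = integral {0..1} (\<lambda>r. of_real (real N * r ^ (N - 1)) * H (r *\<^sub>R z))"

text \<open>The first claim is differentiation under the integral sign. The second integrates the
  derivative in \<open>r\<close> of \<open>r ^ N\<close> times \<open>N * H (r *\<^sub>R z)\<close>:
  one term of the product rule is \<open>N\<close> times the integrand of the mean, the other is the
  integrand of its derivative in direction \<open>z\<close>.\<close>

lemma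
  fixes H :: "complex ^ 'n::finite \<Rightarrow> complex"
  assumes H: "entire_Cd H"
  shows radial_mean_entire: "entire_Cd (radial_mean N H)"
    and radial_mean_euler: "N > 0 \<Longrightarrow> of_nat N * H z =
      of_nat N * radial_mean N H z + frechet_derivative (radial_mean N H) (at z) z"
proof -
  define D where "D x = Blinfun (frechet_derivative H (at x))" for x
  have D: "blinfun_apply (D x) = frechet_derivative H (at x)" for x
    using entire_Cd_has_derivative[OF H, of x]
    by (simp add: D_def has_derivative_bounded_linear bounded_linear_Blinfun_apply)
  have contD: "continuous_on UNIV D"
    by (rule continuous_on_blinfun_componentwise) (simp add: D entire_Cd_derivative_continuous[OF H])
  have derH: "((\<lambda>x. H (r *\<^sub>R x)) has_derivative (\<lambda>v. r *\<^sub>R D (r *\<^sub>R x) v)) (at x)" for x r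
  proof -
    have "(H has_derivative D (r *\<^sub>R x)) (at (r *\<^sub>R x))"
      using entire_Cd_has_derivative[OF H] by (simp add: D)
    from has_derivative_compose[OF bounded_linear_imp_has_derivative[OF bounded_linear_scaleR_right] this]
    show ?thesis by (simp add: blinfun.scaleR_right)
  qed
  \<comment> \<open>The derivative in \<open>z\<close> of the integrand of the radial mean; the last
    factor \<open>r\<close> comes from the dilation.\<close>
  define K where "K z r = (real N * r ^ (N - 1) * r) *\<^sub>R D (r *\<^sub>R z)" for z r
  have contK: "continuous_on (UNIV \<times> cbox 0 1) (\<lambda>(x, r). K x r)"
    unfolding K_def split_beta by (intro continuous_intros continuous_on_compose2[OF contD]) auto
  have intK: "K z integrable_on cbox 0 1" for z
    unfolding K_def by (intro integrable_continuous continuous_intros continuous_on_compose2[OF contD]) auto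
  have Kl: "blinfun_apply (K z r) (c *s v) = c * blinfun_apply (K z r) v" for z r c v
    by (simp add: K_def D entire_Cd_derivative_linear[OF H] blinfun.scaleR_left)
  have "((\<lambda>x. integral (cbox 0 1) (\<lambda>r. of_real (real N * r ^ (N - 1)) * H (r *\<^sub>R x)))
      has_derivative integral (cbox 0 1) (K z)) (at z within UNIV)" for z
  proof (rule leibniz_rule[OF _ _ contK])
    show "((\<lambda>x. complex_of_real (real N * t ^ (N - 1)) * H (t *\<^sub>R x)) has_derivative
           blinfun_apply (K x t)) (at x within UNIV)" for x t
      using has_derivative_mult_right[OF derH[of t x], of "of_real (real N * t ^ (N - 1))"]
      by (auto simp: K_def blinfun.scaleR_left scaleR_conv_of_real[where 'a=complex] mult.assoc elim!: has_derivative_eq_rhs)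
    show "(\<lambda>r. complex_of_real (real N * r ^ (N - 1)) * H (r *\<^sub>R x)) integrable_on cbox 0 1" for x
      by (intro integrable_continuous continuous_intros
          continuous_on_compose2[OF entire_Cd_continuous[OF H, of UNIV]]) auto
  qed auto
  then have der: "(radial_mean N H has_derivative blinfun_apply (integral {0..1} (K z))) (at z)" for z
    by (simp add: radial_mean_def[abs_def])
  have app: "blinfun_apply (integral {0..1} (K z)) v = integral {0..1} (\<lambda>r. blinfun_apply (K z r) v)" for z v
    using intK by (intro blinfun_apply_integral) auto
  show "entire_Cd (radial_mean N H)"
    unfolding entire_Cd_def
  proof (intro allI exI conjI)
    show "(radial_mean N H has_derivative blinfun_apply (integral {0..1} (K z))) (at z)" for z
      by (rule der)
    show "blinfun_apply (integral {0..1} (K z)) (c *s v) = c * blinfun_apply (integral {0..1} (K z)) v" for z c v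
      by (simp add: app Kl)
  qed
  assume N: "N > 0"
  have fd: "frechet_derivative (radial_mean N H) (at z) = blinfun_apply (integral {0..1} (K z))"
    using der frechet_derivative_at by metis
  \<comment> \<open>The boundary term at \<open>0\<close> vanishes below because
    \<open>N > 0\<close>.\<close>
  have "((\<lambda>r. of_real (real N * r ^ (N - 1)) * (of_nat N * H (r *\<^sub>R z)) +
           of_real (r ^ N) * (of_nat N * D (r *\<^sub>R z) z)) has_integral
         of_real (1 ^ N) * (of_nat N * H (1 *\<^sub>R z)) - of_real (0 ^ N) * (of_nat N * H (0 *\<^sub>R z))) {0..1}"
  proof (rule fundamental_theorem_of_calculus)
    fix r :: real
    have "((\<lambda>r. H (r *\<^sub>R z)) has_derivative (\<lambda>h. D (r *\<^sub>R z) (h *\<^sub>R z))) (at r)"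
    proof -
      have "(H has_derivative D (r *\<^sub>R z)) (at (r *\<^sub>R z))"
        using entire_Cd_has_derivative[OF H] by (simp add: D)
      from has_derivative_compose[OF bounded_linear_imp_has_derivative[OF bounded_linear_scaleR_left] this]
      show ?thesis .
    qed
    then have "((\<lambda>r. H (r *\<^sub>R z)) has_vector_derivative D (r *\<^sub>R z) z) (at r within {0..1})"
      unfolding has_vector_derivative_def
      by (rule has_derivative_at_withinI[OF has_derivative_eq_rhs]) (rule ext, rule blinfun.scaleR_right)
    then have 1: "((\<lambda>r. of_nat N * H (r *\<^sub>R z)) has_vector_derivative of_nat N * D (r *\<^sub>R z) z) (at r within {0..1})"
      by (rule has_vector_derivative_mult_right)
    have "((\<lambda>r. r ^ N) has_real_derivative real N * r ^ (N - 1)) (at r within {0..1})"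
      by (auto intro!: derivative_eq_intros)
    then have "((\<lambda>r. complex_of_real (r ^ N)) has_vector_derivative of_real (real N * r ^ (N - 1))) (at r within {0..1})"
      by (intro has_vector_derivative_of_real) (simp add: has_real_derivative_iff_has_vector_derivative)
    from has_vector_derivative_mult[OF this 1]
    show "((\<lambda>r. of_real (r ^ N) * (of_nat N * H (r *\<^sub>R z))) has_vector_derivative
        of_real (real N * r ^ (N - 1)) * (of_nat N * H (r *\<^sub>R z)) +
           of_real (r ^ N) * (of_nat N * D (r *\<^sub>R z) z)) (at r within {0..1})"
      by (simp only: add.commute)
  qed simp
  moreover have "K z r z = of_real (r ^ N) * (of_nat N * D (r *\<^sub>R z) z)" for r
    using N by (cases N) (simp_all add: K_def blinfun.scaleR_left scaleR_conv_of_real[where 'a=complex])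
  ultimately have "((\<lambda>r. of_nat N * (of_real (real N * r ^ (N - 1)) * H (r *\<^sub>R z)) + K z r z) has_integral of_nat N * H z) {0..1}"
    using N by (simp add: mult.left_commute power_0_left)
  moreover have "((\<lambda>r. of_nat N * (of_real (real N * r ^ (N - 1)) * H (r *\<^sub>R z)) + K z r z) has_integral
      of_nat N * integral {0..1} (\<lambda>r. of_real (real N * r ^ (N - 1)) * H (r *\<^sub>R z)) + integral {0..1} (\<lambda>r. K z r z)) {0..1}"
  proof (rule has_integral_add)
    have "(\<lambda>r. of_real (real N * r ^ (N - 1)) * H (r *\<^sub>R z)) integrable_on {0..1}"
      by (intro integrable_continuous_interval continuous_intros
          continuous_on_compose2[OF entire_Cd_continuous[OF H, of UNIV]]) auto
    then show "((\<lambda>r. of_nat N * (of_real (real N * r ^ (N - 1)) * H (r *\<^sub>R z))) has_integral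
      of_nat N * integral {0..1} (\<lambda>r. of_real (real N * r ^ (N - 1)) * H (r *\<^sub>R z))) {0..1}"
      by (intro has_integral_mult_right integrable_integral)
    have "(\<lambda>r. K z r z) integrable_on {0..1}"
      using integrable_linear[OF intK blinfun.bounded_linear_left, of z z] by (simp add: o_def)
    then show "((\<lambda>r. K z r z) has_integral integral {0..1} (\<lambda>r. K z r z)) {0..1}"
      by (rule integrable_integral)
  qed
  ultimately show "of_nat N * H z =
      of_nat N * radial_mean N H z + frechet_derivative (radial_mean N H) (at z) z"
    unfolding fd app radial_mean_def by (rule has_integral_unique)
qed

section \<open>Weights and norms in the Fock space\<close>

lemma measurable_fock_weight_fun:
  assumes "entire_Cd F"
  shows "fock_weight_fun F \<in> borel_measurable borel"
  unfolding fock_weight_fun_def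
  by (intro borel_measurable_continuous_onI continuous_intros entire_Cd_continuous[OF assms])

lemma fock_weight_fun_nonneg: "fock_weight_fun F z \<ge> 0"
  by (simp add: fock_weight_fun_def)

lemma fock_spaceI:
  assumes "entire_Cd F" "(\<integral>\<^sup>+z. fock_weight_fun F z \<partial>lborel) < \<infinity>"
  shows "F \<in> fock_space"
  using assms measurable_fock_weight_fun[OF assms(1)]
  by (auto simp: fock_space_def fock_weight_fun_nonneg intro!: integrableI_nonneg)

lemma nn_integral_fock_weight_fun:
  assumes "F \<in> fock_space"
  shows "(\<integral>\<^sup>+z. fock_weight_fun F z \<partial>lborel) = ennreal (fock_norm2 F)"
  using assms unfolding fock_space_def fock_norm2_def
  by (auto intro!: nn_integral_eq_integral simp: fock_weight_fun_nonneg)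

lemma fock_norm2_nonneg: "fock_norm2 F \<ge> 0"
  unfolding fock_norm2_def by (simp add: fock_weight_fun_nonneg)

text \<open>The set where \<open>F\<close> is nonzero is open by continuity and null by the
  hypothesis, hence empty.\<close>

lemma fock_norm2_eq_0_imp:
  assumes "F \<in> fock_space" "fock_norm2 F = 0"
  shows "F z = 0"
proof (rule ccontr)
  assume "F z \<noteq> 0"
  have F: "entire_Cd F" "integrable lborel (fock_weight_fun F)"
    using assms(1) by (auto simp: fock_space_def)
  have "AE w in lborel. fock_weight_fun F w = 0"
    using assms(2) integral_nonneg_eq_0_iff_AE[OF F(2)]
    by (simp add: fock_norm2_def fock_weight_fun_nonneg)
  then have "AE w in lborel. F w = 0"
    by eventually_elim (simp add: fock_weight_fun_def)
  moreover have "open {w. F w \<noteq> 0}"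
    using open_vimage[of "- {0}" F] entire_Cd_continuous[OF F(1), of UNIV]
    by (auto simp: vimage_def Compl_eq[symmetric])
  ultimately have "{w. F w \<noteq> 0} \<in> null_sets lborel"
    by (subst (asm) AE_iff_null) auto
  then have "negligible {w. F w \<noteq> 0}"
    by (simp add: negligible_iff_null_sets null_sets_completionI)
  with open_not_negligible[OF \<open>open {w. F w \<noteq> 0}\<close>] \<open>F z \<noteq> 0\<close> show False
    by auto
qed

lemma integrable_exp_neg_pi_norm_square:
  "integrable lborel (\<lambda>z :: 'a :: euclidean_space. exp (- pi * (norm z)\<^sup>2))"
proof -
  have 1: "integrable lborel (\<lambda>x::real. exp (- pi * x\<^sup>2))"
  proof -
    \<comment> \<open>Variance \<open>1 / (2 * pi)\<close> makes the normalising constant of the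
      Gaussian equal to one.\<close>
    have "normal_density 0 (sqrt (1 / (2 * pi))) = (\<lambda>x. exp (- pi * x\<^sup>2))"
      by (auto simp: normal_density_def field_simps)
    then show ?thesis
      using integrable_normal_density[of "sqrt (1 / (2 * pi))" 0] by simp
  qed
  interpret product_sigma_finite "\<lambda>b::'a. lborel :: real measure" ..
  have "integrable (\<Pi>\<^sub>M b\<in>(Basis :: 'a set). lborel) (\<lambda>f. \<Prod>b\<in>Basis. exp (- pi * (f b)\<^sup>2))"
    by (rule product_integrable_prod) (use 1 in simp_all)
  moreover have "(\<Prod>b\<in>Basis. exp (- pi * (f b)\<^sup>2)) =
      exp (- pi * (norm (\<Sum>b\<in>Basis. f b *\<^sub>R b :: 'a))\<^sup>2)" for f :: "'a \<Rightarrow> real"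
  proof -
    have "(norm (\<Sum>b\<in>Basis. f b *\<^sub>R b :: 'a))\<^sup>2 = (\<Sum>b\<in>Basis. (f b)\<^sup>2)"
      unfolding power2_norm_eq_inner by (subst euclidean_inner) (simp add: power2_eq_square)
    then show ?thesis
      by (simp add: exp_sum[symmetric] sum_distrib_left)
  qed
  ultimately show ?thesis
    by (subst lborel_eq, subst integrable_distr_eq) auto
qed

lemma one_in_fock_space: "(\<lambda>_. 1) \<in> fock_space"
  using integrable_exp_neg_pi_norm_square
  by (auto simp: fock_space_def fock_weight_fun_def[abs_def] entire_Cd_def intro!: exI[of _ "\<lambda>_. 0"])

section \<open>Bargmann shifts\<close>

lemma norm_axis_add_square:
  "(norm (w + axis j a :: complex ^ 'n::finite))\<^sup>2 = (norm w)\<^sup>2 + 2 * Re (cnj a * w $ j) + (cmod a)\<^sup>2"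
proof -
  have "(norm (w + axis j a))\<^sup>2 = (norm w)\<^sup>2 + 2 * (w \<bullet> axis j a) + (norm (axis j a))\<^sup>2"
    by (simp add: power2_norm_eq_inner inner_add_left inner_add_right inner_commute)
  moreover have "(norm (axis j a :: complex ^ 'n))\<^sup>2 = (cmod a)\<^sup>2"
    by (simp add: power2_norm_eq_inner inner_axis_axis)
  ultimately show ?thesis
    by (simp add: inner_axis inner_complex_def algebra_simps)
qed

text \<open>\<open>G j a\<close> is the Bargmann shift by \<open>a\<close> along coordinate
  \<open>j\<close>. Its exponential factor is entire in \<open>w\<close>, since only
  \<open>a\<close> is conjugated, and its squared modulus is exactly the quotient of the Gaussians
  at \<open>w + axis j a\<close> and \<open>w\<close>. Translation invariance of Lebesgue measure
  then gives equal norms.\<close>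

lemma
  fixes F :: "complex ^ 'n::finite \<Rightarrow> complex"
  assumes F: "F \<in> fock_space"
  defines "G \<equiv> \<lambda>j a w. F (w + axis j a) * exp (- of_real pi * cnj a * w $ j - of_real (pi * (cmod a)\<^sup>2 / 2))"
  shows fock_shift_in_fock_space: "G j a \<in> fock_space"
    and fock_weight_fun_shift: "fock_weight_fun (G j a) w = fock_weight_fun F (w + axis j a)"
    and fock_norm2_shift: "fock_norm2 (G j a) = fock_norm2 F"
proof -
  have E: "entire_Cd F"
    using F by (simp add: fock_space_def)
  show eq: "fock_weight_fun (G j a) w = fock_weight_fun F (w + axis j a)" for w
  proof -
    have "(exp (- (pi * Re (cnj a * w $ j)) - pi * (cmod a)\<^sup>2 / 2))\<^sup>2 * exp (- pi * (norm w)\<^sup>2) =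
        exp (- pi * (norm (w + axis j a))\<^sup>2)"
      unfolding norm_axis_add_square
      by (simp add: exp_double[symmetric] exp_add[symmetric] algebra_simps)
    then show ?thesis
      by (simp add: fock_weight_fun_def G_def norm_mult norm_exp_eq_Re power_mult_distrib mult.assoc)
  qed
  have "entire_Cd (G j a)"
    unfolding entire_Cd_def
  proof (intro allI exI conjI)
    fix z
    have t: "((\<lambda>w. w + axis j a) has_derivative (\<lambda>v. v)) (at z)"
      by (auto intro!: derivative_eq_intros)
    have n: "((\<lambda>w. w $ j) has_derivative (\<lambda>v. v $ j)) (at z)"
      by (rule bounded_linear_imp_has_derivative) (rule bounded_linear_vec_nth)
    have l: "((\<lambda>w. - of_real pi * cnj a * w $ j - of_real (pi * (cmod a)\<^sup>2 / 2)) has_derivative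
        (\<lambda>v. - of_real pi * cnj a * v $ j - 0)) (at z)"
      by (intro has_derivative_diff has_derivative_mult_right n has_derivative_const)
    show "(G j a has_derivative (\<lambda>v. F (z + axis j a) * (exp (- of_real pi * cnj a * z $ j - of_real (pi * (cmod a)\<^sup>2 / 2)) *
          (- of_real pi * cnj a * v $ j)) + frechet_derivative F (at (z + axis j a)) v *
          exp (- of_real pi * cnj a * z $ j - of_real (pi * (cmod a)\<^sup>2 / 2)))) (at z)"
      unfolding G_def
      using has_derivative_mult[OF has_derivative_compose[OF t entire_Cd_has_derivative[OF E]]
          has_derivative_compose[OF l DERIV_exp[unfolded has_field_derivative_def]]]
      by simp
    fix c v
    show "(F (z + axis j a) * (exp (- of_real pi * cnj a * z $ j - of_real (pi * (cmod a)\<^sup>2 / 2)) *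
          (- of_real pi * cnj a * (c *s v) $ j)) + frechet_derivative F (at (z + axis j a)) (c *s v) *
          exp (- of_real pi * cnj a * z $ j - of_real (pi * (cmod a)\<^sup>2 / 2))) =
        c * (F (z + axis j a) * (exp (- of_real pi * cnj a * z $ j - of_real (pi * (cmod a)\<^sup>2 / 2)) *
          (- of_real pi * cnj a * v $ j)) + frechet_derivative F (at (z + axis j a)) v *
          exp (- of_real pi * cnj a * z $ j - of_real (pi * (cmod a)\<^sup>2 / 2)))"
      by (simp add: entire_Cd_derivative_linear[OF E] algebra_simps)
  qed
  moreover have "(\<integral>\<^sup>+w. fock_weight_fun (G j a) w \<partial>lborel) = ennreal (fock_norm2 F)"
  proof -
    have "(\<integral>\<^sup>+w. fock_weight_fun (G j a) w \<partial>lborel) =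
        (\<integral>\<^sup>+w. fock_weight_fun F w \<partial>distr lborel borel (\<lambda>w. axis j a + w))"
      using measurable_fock_weight_fun[OF E] by (subst nn_integral_distr) (auto simp: eq add.commute)
    then show ?thesis
      using nn_integral_fock_weight_fun[OF F] by (simp add: lborel_distr_plus)
  qed
  ultimately show G: "G j a \<in> fock_space"
    by (intro fock_spaceI) auto
  show "fock_norm2 (G j a) = fock_norm2 F"
    using nn_integral_fock_weight_fun[OF G] \<open>_ = ennreal (fock_norm2 F)\<close>
    by (simp add: fock_norm2_nonneg)
qed

section \<open>Membership of radial means in the Fock space\<close>

lemma entire_Cd_continuous_compose [continuous_intros]:
  assumes "entire_Cd F" "continuous_on S f"
  shows "continuous_on S (\<lambda>x. F (f x))"
  by (rule continuous_on_compose2[OF entire_Cd_continuous[OF assms(1), of UNIV] assms(2)]) auto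

text \<open>Substitution \<open>r = 1 - s\<^sup>2\<close>. The Jacobian \<open>2 * s\<close>
  vanishes at \<open>r = 1\<close> and contributes a factor \<open>s\<^sup>2 = 1 - r\<close> once
  the integrand is squared.\<close>

lemma radial_mean_substitution:
  fixes H :: "complex ^ 'n::finite \<Rightarrow> complex"
  assumes H: "entire_Cd H"
  shows "radial_mean N H z = integral {0..1} (\<lambda>s.
    of_real (2 * s * (real N * (1 - s\<^sup>2) ^ (N - 1))) * H ((1 - s\<^sup>2) *\<^sub>R z))"
proof -
  define h where "h r = of_real (real N * r ^ (N - 1)) * H (r *\<^sub>R z)" for r
  have "((\<lambda>s. (- 2 * s) *\<^sub>R h (1 - s\<^sup>2)) has_integral
      (integral {1 - 0\<^sup>2..1 - 1\<^sup>2} h - integral {1 - 1\<^sup>2..1 - 0\<^sup>2} h)) {0..1}"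
  proof (rule has_integral_substitution_general[of "{}" 0 1 _ 0 1])
    show "continuous_on {0..1} h"
      unfolding h_def by (intro continuous_intros H)
    show "(\<lambda>s::real. 1 - s\<^sup>2) ` {0..1} \<subseteq> {0..1}"
      by (auto simp: power_le_one)
  qed (auto intro!: continuous_intros derivative_eq_intros)
  then have "((\<lambda>s. - ((- 2 * s) *\<^sub>R h (1 - s\<^sup>2))) has_integral - (0 - integral {0..1} h)) {0..1}"
    by (intro has_integral_neg) simp
  then have "((\<lambda>s. of_real (2 * s * (real N * (1 - s\<^sup>2) ^ (N - 1))) * H ((1 - s\<^sup>2) *\<^sub>R z))
      has_integral radial_mean N H z) {0..1}"
    by (simp add: h_def[abs_def] radial_mean_def scaleR_conv_of_real[where 'a=complex] mult.assoc)
  then show ?thesis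
    by (rule integral_unique[symmetric])
qed

lemma nn_integral_lborel_scaleR:
  fixes f :: "'a::euclidean_space \<Rightarrow> ennreal"
  assumes "f \<in> borel_measurable borel" "r > 0"
  shows "(\<integral>\<^sup>+x. ennreal (r ^ DIM('a)) * f (r *\<^sub>R x) \<partial>lborel) = (\<integral>\<^sup>+x. f x \<partial>lborel)"
  using assms
  by (subst (2) lborel_affine[of r 0]) (auto simp: nn_integral_density nn_integral_distr)

lemma radial_mean_in_fock_space:
  fixes H :: "complex ^ 'n::finite \<Rightarrow> complex"
  assumes H: "entire_Cd H" and F: "F \<in> fock_space"
    and bound: "\<And>z. (cmod (H z))\<^sup>2 \<le> C * (1 + (norm z)\<^sup>2) * (cmod (F z))\<^sup>2"
    and N: "DIM(complex ^ 'n) \<le> 2 * (N - 1)"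
  shows "radial_mean N H \<in> fock_space"
proof (rule fock_spaceI)
  \<comment> \<open>The dilate \<open>H (r z)\<close> has squared norm of order \<open>1 / (1 - r)\<close>; the substitution \<open>r = 1 - s\<^sup>2\<close>
    absorbs this singularity in the Cauchy--Schwarz inequality.\<close>
  have E: "entire_Cd F"
    using F by (simp add: fock_space_def)
  \<comment> \<open>Enlarging the constant makes it nonnegative, so that \<open>K\<close> below is
    nonnegative too.\<close>
  have "0 \<le> max C 0" "\<And>z. (cmod (H z))\<^sup>2 \<le> max C 0 * (1 + (norm z)\<^sup>2) * (cmod (F z))\<^sup>2"
    using order_trans[OF bound mult_right_mono[OF mult_right_mono]] by auto
  then obtain C where C: "C \<ge> 0" "\<And>z. (cmod (H z))\<^sup>2 \<le> C * (1 + (norm z)\<^sup>2) * (cmod (F z))\<^sup>2"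
    by blast
  define P where "P s z = (cmod (of_real (2 * s * (real N * (1 - s\<^sup>2) ^ (N - 1))) * H ((1 - s\<^sup>2) *\<^sub>R z)))\<^sup>2
      * exp (- pi * (norm z)\<^sup>2)" for s z
  have nonneg: "P s z \<ge> 0" for s z
    by (simp add: P_def)
  define K where "K = 4 * (real N)\<^sup>2 * C"
  have K: "K \<ge> 0"
    using C by (simp add: K_def)

  \<comment> \<open>The aim is a bound by the weight of \<open>F\<close> at the dilated point, with
    the power of \<open>r\<close> that a change of variables in real dimension
    \<open>DIM(complex ^ 'n)\<close> consumes.\<close>
  have P_le: "P s z \<le> K * ((1 - s\<^sup>2) ^ DIM(complex ^ 'n) * fock_weight_fun F ((1 - s\<^sup>2) *\<^sub>R z))"
    if s: "s \<in> {0..1}" for s z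
  proof -
    define r where "r = 1 - s\<^sup>2"
    have s1: "s\<^sup>2 \<le> 1"
      using s by (simp add: power_le_one)
    then have r: "0 \<le> r" "r \<le> 1"
      by (simp_all add: r_def)
    have "1 - r\<^sup>2 - s\<^sup>2 = s\<^sup>2 * r"
      by (simp add: r_def power2_eq_square algebra_simps)
    moreover have "s\<^sup>2 * r \<ge> 0"
      using r(1) by simp
    ultimately have r2: "s\<^sup>2 \<le> 1 - r\<^sup>2"
      by linarith
    \<comment> \<open>The polynomial factor is absorbed by the gap between the Gaussians at
      \<open>z\<close> and at \<open>r *\<^sub>R z\<close>: the factor \<open>s\<^sup>2\<close>
      keeps its growth below \<open>exp (s\<^sup>2 * (norm z)\<^sup>2)\<close>, and
      \<open>s\<^sup>2 \<le> 1 - r\<^sup>2\<close>.\<close>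
    have "s\<^sup>2 * (1 + (norm (r *\<^sub>R z))\<^sup>2) \<le> 1 + s\<^sup>2 * (norm z)\<^sup>2"
    proof -
      have "(norm (r *\<^sub>R z))\<^sup>2 \<le> (norm z)\<^sup>2"
        using r by (intro power_mono) (auto intro: mult_left_le_one_le)
      then show ?thesis
        using s1 by (simp add: distrib_left add_mono mult_left_mono)
    qed
    also have "\<dots> \<le> exp (s\<^sup>2 * (norm z)\<^sup>2)"
      by (rule exp_ge_add_one_self)
    also have "\<dots> \<le> exp (pi * ((1 - r\<^sup>2) * (norm z)\<^sup>2))"
    proof -
      have "1 * (s\<^sup>2 * (norm z)\<^sup>2) \<le> pi * ((1 - r\<^sup>2) * (norm z)\<^sup>2)"
        using r2 r pi_gt3 by (intro mult_mono) (auto simp: power_le_one)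
      then show ?thesis by simp
    qed
    finally have "s\<^sup>2 * (1 + (norm (r *\<^sub>R z))\<^sup>2) * exp (- pi * (norm z)\<^sup>2) \<le>
        exp (pi * ((1 - r\<^sup>2) * (norm z)\<^sup>2)) * exp (- pi * (norm z)\<^sup>2)"
      by (rule mult_right_mono) simp
    also have "\<dots> = exp (- pi * (norm (r *\<^sub>R z))\<^sup>2)"
      by (simp add: exp_add[symmetric] power_mult_distrib algebra_simps)
    finally have gauss: "s\<^sup>2 * (1 + (norm (r *\<^sub>R z))\<^sup>2) * exp (- pi * (norm z)\<^sup>2) \<le> exp (- pi * (norm (r *\<^sub>R z))\<^sup>2)" .
    \<comment> \<open>The lower bound on \<open>N\<close> enters here: the density has enough powers
      of \<open>r\<close> to pay for the Jacobian of the dilation.\<close>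
    have rpow: "(r ^ (N - 1))\<^sup>2 \<le> r ^ DIM(complex ^ 'n)"
      unfolding power_mult[symmetric] using r N by (intro power_decreasing) (auto simp: mult.commute)
    have "P s z = 4 * (real N)\<^sup>2 * (r ^ (N - 1))\<^sup>2 * (s\<^sup>2 * exp (- pi * (norm z)\<^sup>2)) * (cmod (H (r *\<^sub>R z)))\<^sup>2"
      by (simp add: P_def norm_mult power_mult_distrib r_def[symmetric] del: of_real_mult of_real_power)
    also have "\<dots> \<le> 4 * (real N)\<^sup>2 * (r ^ (N - 1))\<^sup>2 * (s\<^sup>2 * exp (- pi * (norm z)\<^sup>2)) *
        (C * (1 + (norm (r *\<^sub>R z))\<^sup>2) * (cmod (F (r *\<^sub>R z)))\<^sup>2)"
      by (intro mult_left_mono C) auto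
    also have "\<dots> = K * ((r ^ (N - 1))\<^sup>2 * ((cmod (F (r *\<^sub>R z)))\<^sup>2 *
        (s\<^sup>2 * (1 + (norm (r *\<^sub>R z))\<^sup>2) * exp (- pi * (norm z)\<^sup>2))))"
      by (simp add: K_def)
    also have "\<dots> \<le> K * (r ^ DIM(complex ^ 'n) * ((cmod (F (r *\<^sub>R z)))\<^sup>2 * exp (- pi * (norm (r *\<^sub>R z))\<^sup>2)))"
      using r K by (intro mult_left_mono mult_mono gauss rpow mult_nonneg_nonneg) auto
    finally show ?thesis
      by (simp only: fock_weight_fun_def r_def)
  qed

  have inner: "(\<integral>\<^sup>+z. ennreal (P s z) * indicator {0..1} s \<partial>lborel) \<le>
      ennreal (K * fock_norm2 F) * indicator {0..1} s" for s
  proof (cases "s \<in> {0..1}")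
    case True
    define r where "r = 1 - s\<^sup>2"
    have r: "0 \<le> r"
      using True by (auto simp: r_def power_le_one)
    have "(\<integral>\<^sup>+z. ennreal (P s z) \<partial>lborel) \<le>
        (\<integral>\<^sup>+z. ennreal K * (ennreal (r ^ DIM(complex ^ 'n)) * ennreal (fock_weight_fun F (r *\<^sub>R z))) \<partial>lborel)"
      using P_le[OF True] K r
      by (intro nn_integral_mono)
         (simp add: ennreal_mult'[symmetric] ennreal_mult''[symmetric] fock_weight_fun_nonneg r_def ennreal_leI)
    also have "\<dots> = ennreal K * (\<integral>\<^sup>+z. ennreal (r ^ DIM(complex ^ 'n)) * ennreal (fock_weight_fun F (r *\<^sub>R z)) \<partial>lborel)"
      by (intro nn_integral_cmult borel_measurable_times_ennreal borel_measurable_const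
          measurable_compose[OF _ measurable_ennreal]
          measurable_compose[OF _ measurable_fock_weight_fun[OF E]]) simp
    also have "\<dots> \<le> ennreal K * (\<integral>\<^sup>+z. ennreal (fock_weight_fun F z) \<partial>lborel)"
    \<comment> \<open>At \<open>s = 1\<close> the dilation is not invertible, but the factor
      \<open>r ^ DIM(complex ^ 'n)\<close> is then zero.\<close>
    proof (cases "r = 0")
      case False
      with r show ?thesis
        by (subst nn_integral_lborel_scaleR) (use measurable_fock_weight_fun[OF E] in auto)
    qed (simp add: power_0_left)
    finally show ?thesis
      using True K by (simp add: nn_integral_fock_weight_fun[OF F] ennreal_mult' )
  qed simp

  show ent: "entire_Cd (radial_mean N H)"
    by (rule radial_mean_entire[OF H])
  \<comment> \<open>Cauchy--Schwarz in \<open>s\<close>; afterwards Tonelli lets the integral over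
    \<open>z\<close> be done first, where \<open>inner\<close> bounds it uniformly in
    \<open>s\<close>.\<close>
  have "fock_weight_fun (radial_mean N H) z \<le> integral {0..1} (\<lambda>s. P s z)" for z
    unfolding fock_weight_fun_def radial_mean_substitution[OF H] P_def integral_mult_left
    by (intro mult_right_mono integral_norm_square_le continuous_intros H) auto
  moreover have "((\<lambda>s. P s z) has_integral integral {0..1} (\<lambda>s. P s z)) {0..1}" for z
    unfolding P_def by (intro integrable_integral integrable_continuous_interval continuous_intros H)
  ultimately have "ennreal (fock_weight_fun (radial_mean N H) z) \<le>
      (\<integral>\<^sup>+s. ennreal (P s z) * indicator {0..1} s \<partial>lborel)" for z
    by (subst nn_integral_has_integral_lebesgue'[OF nonneg]) (auto intro!: ennreal_leI)
  then have "(\<integral>\<^sup>+z. fock_weight_fun (radial_mean N H) z \<partial>lborel) \<le>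
      (\<integral>\<^sup>+z. (\<integral>\<^sup>+s. ennreal (P s z) * indicator {0..1} s \<partial>lborel) \<partial>lborel)"
    by (intro nn_integral_mono)
  also have "\<dots> = (\<integral>\<^sup>+s. (\<integral>\<^sup>+z. ennreal (P s z) * indicator {0..1} s \<partial>lborel) \<partial>lborel)"
  proof (rule lborel_pair.Fubini')
    have "(\<lambda>p. P (fst p) (snd p)) \<in> borel_measurable (borel :: (real \<times> (complex ^ 'n)) measure)"
      unfolding P_def by (intro borel_measurable_continuous_onI continuous_intros H)
    then have "(\<lambda>p. ennreal (P (fst p) (snd p)) * indicator ({0..1} \<times> UNIV) p) \<in> borel_measurable borel"
      by (intro borel_measurable_times_ennreal measurable_compose[OF _ measurable_ennreal]
          borel_measurable_indicator borel_closed closed_Times) auto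
    moreover have "(\<lambda>p. ennreal (P (fst p) (snd p)) * indicator ({0..1} \<times> UNIV) p) =
        (\<lambda>(s, z). ennreal (P s z) * indicator {0..1} s)"
      by (auto simp: fun_eq_iff indicator_def)
    ultimately show "(\<lambda>(s, z). ennreal (P s z) * indicator {0..1} s) \<in> borel_measurable (lborel \<Otimes>\<^sub>M lborel)"
      by (simp add: lborel_prod)
  qed
  also have "\<dots> \<le> (\<integral>\<^sup>+s. ennreal (K * fock_norm2 F) * indicator {0..1::real} s \<partial>lborel)"
    by (intro nn_integral_mono inner)
  also have "\<dots> < \<infinity>"
    by (simp add: nn_integral_cmult_indicator)
  finally show "(\<integral>\<^sup>+z. fock_weight_fun (radial_mean N H) z \<partial>lborel) < \<infinity>" .
qed

section \<open>Sampled sums of covariant derivatives\<close>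

text \<open>Bargmann shifts are unitary, so an upper sampling bound at \<open>S\<close> holds with the same constant at
  every translate of \<open>S\<close>, and Cauchy's formula on the unit circle expresses the covariant derivative
  at \<open>w\<close> through values at translates of \<open>w\<close>.\<close>

lemma covariant_derivative_upper_bound:
  fixes G :: "complex ^ 'n::finite \<Rightarrow> complex"
  assumes G: "G \<in> fock_space" and S: "finite S"
    and B: "\<And>F. F \<in> fock_space \<Longrightarrow> (\<Sum>w\<in>S. fock_weight_fun F w) \<le> B * fock_norm2 F"
  shows "(\<Sum>w\<in>S. (cmod (frechet_derivative G (at w) (axis j 1) - of_real pi * cnj (w $ j) * G w))\<^sup>2
            * exp (- pi * (norm w)\<^sup>2)) \<le> exp pi * B * fock_norm2 G"
proof -
  have E: "entire_Cd G"
    using G by (simp add: fock_space_def)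
  define e where "e t = exp (2 * of_real pi * \<i> * of_real t)" for t :: real
  have e: "continuous_on A e" "cmod (e t) = 1" for A t
    unfolding e_def by (auto intro!: continuous_intros simp: norm_exp_eq_Re)
  have axis: "c *s axis j 1 = (axis j c :: complex ^ 'n)" for c
    by (simp add: vec_eq_iff axis_def)
  have cont: "continuous_on A (\<lambda>t. axis j (e t) :: complex ^ 'n)" for A
  proof -
    have "continuous_on A (\<lambda>t. e t *s axis j 1 :: complex ^ 'n)"
      by (intro continuous_intros e)
    then show ?thesis
      by (simp only: axis)
  qed
  have pointwise: "(cmod (frechet_derivative G (at w) (axis j 1) - of_real pi * cnj (w $ j) * G w))\<^sup>2
        * exp (- pi * (norm w)\<^sup>2) \<le> integral {0..1} (\<lambda>t. exp pi * fock_weight_fun G (w + axis j (e t)))" for w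
  proof -
    \<comment> \<open>The twist by the exponential makes the derivative of \<open>g\<close> at
      \<open>0\<close> the covariant derivative of \<open>G\<close> at \<open>w\<close>, and makes
      the modulus of \<open>g\<close> on the unit circle that of a Bargmann shift of
      \<open>G\<close>, up to a constant.\<close>
    define g where "g c = G (w + c *s axis j 1) * exp (- of_real pi * cnj (w $ j) * c)" for c
    have dg: "(g has_field_derivative
        frechet_derivative G (at (w + c *s axis j 1)) (axis j 1) * exp (- of_real pi * cnj (w $ j) * c) +
        (exp (- of_real pi * cnj (w $ j) * c) * (- of_real pi * cnj (w $ j))) * G (w + c *s axis j 1)) (at c)" for c
    proof -
      have "((\<lambda>c. exp (k * c)) has_field_derivative exp (k * c) * k) (at c)" for k :: complex
        by (auto intro!: derivative_eq_intros)
      from DERIV_mult[OF entire_Cd_has_field_derivative_line[OF E] this] show ?thesis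
        unfolding g_def .
    qed
    have "g holomorphic_on UNIV"
      using dg by (auto simp: holomorphic_on_open)
    from deriv_as_circle_average[OF this]
    have "frechet_derivative G (at w) (axis j 1) - of_real pi * cnj (w $ j) * G w =
        integral {0..1} (\<lambda>t. g (e t) * exp (- (2 * of_real pi * \<i> * of_real t)))"
      using DERIV_imp_deriv[OF dg[of 0]] by (simp add: e_def mult_ac)
    moreover have "continuous_on {0..1} (\<lambda>t. g (e t) * exp (- (2 * of_real pi * \<i> * of_real t)))"
      unfolding g_def by (intro continuous_intros E e)
    ultimately have "(cmod (frechet_derivative G (at w) (axis j 1) - of_real pi * cnj (w $ j) * G w))\<^sup>2
        * exp (- pi * (norm w)\<^sup>2) \<le>
        integral {0..1} (\<lambda>t. (cmod (g (e t) * exp (- (2 * of_real pi * \<i> * of_real t))))\<^sup>2) * exp (- pi * (norm w)\<^sup>2)"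
      using integral_norm_square_le by (intro mult_right_mono) auto
    also have "\<dots> = integral {0..1} (\<lambda>t. exp pi * fock_weight_fun G (w + axis j (e t)))"
      unfolding integral_mult_left[symmetric]
    proof (rule Henstock_Kurzweil_Integration.integral_cong)
      fix t
      \<comment> \<open>The factor \<open>exp pi\<close> compensates the term
        \<open>(cmod (e t))\<^sup>2 = 1\<close> in the expansion of the squared norm.\<close>
      have "exp pi * exp (- pi * (norm (w + axis j (e t)))\<^sup>2) =
          (exp (- (pi * Re (cnj (e t) * w $ j))))\<^sup>2 * exp (- pi * (norm w)\<^sup>2)"
        unfolding norm_axis_add_square
        by (simp add: e exp_double[symmetric] exp_add[symmetric] algebra_simps)
      then show "(cmod (g (e t) * exp (- (2 * of_real pi * \<i> * of_real t))))\<^sup>2 * exp (- pi * (norm w)\<^sup>2) =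
          exp pi * fock_weight_fun G (w + axis j (e t))"
        by (simp add: g_def axis fock_weight_fun_def norm_mult norm_exp_eq_Re power_mult_distrib algebra_simps)
    qed
    finally show ?thesis .
  qed
  have cont_w: "continuous_on A (\<lambda>t. fock_weight_fun G (w + axis j (e t)))" for A w
    unfolding fock_weight_fun_def by (intro continuous_intros E cont)
  have "(\<Sum>w\<in>S. (cmod (frechet_derivative G (at w) (axis j 1) - of_real pi * cnj (w $ j) * G w))\<^sup>2
            * exp (- pi * (norm w)\<^sup>2)) \<le>
      (\<Sum>w\<in>S. integral {0..1} (\<lambda>t. exp pi * fock_weight_fun G (w + axis j (e t))))"
    by (intro sum_mono pointwise)
  also have "\<dots> = integral {0..1} (\<lambda>t. \<Sum>w\<in>S. exp pi * fock_weight_fun G (w + axis j (e t)))"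
    by (intro integral_sum[symmetric] S integrable_continuous_interval continuous_intros cont_w)
  also have "\<dots> \<le> integral {0..1} (\<lambda>t::real. exp pi * B * fock_norm2 G)"
  proof (rule integral_le)
    fix t
    \<comment> \<open>For fixed \<open>t\<close>, moving the translation from the points to the
      function lets the hypothesis on \<open>S\<close> apply.\<close>
    have "(\<Sum>w\<in>S. fock_weight_fun G (w + axis j (e t))) \<le> B * fock_norm2 G"
      using B[OF fock_shift_in_fock_space[OF G, of j "e t"]]
      by (simp only: fock_weight_fun_shift[OF G] fock_norm2_shift[OF G])
    then show "(\<Sum>w\<in>S. exp pi * fock_weight_fun G (w + axis j (e t))) \<le> exp pi * B * fock_norm2 G"
      by (simp add: sum_distrib_left[symmetric] mult.assoc)
  qed (auto intro!: integrable_continuous_interval continuous_intros cont_w)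
  finally show ?thesis
    by simp
qed

section \<open>The contradiction between sampling and interpolation\<close>

theorem mainTheorem9:
  fixes \<Lambda> :: "(complex ^ 'n::finite) set"
  shows "\<not> (sampling_set \<Lambda> \<and> interpolating_set \<Lambda>)"
proof
  assume "sampling_set \<Lambda> \<and> interpolating_set \<Lambda>"
  then obtain A B where A: "0 < A" and
    samp: "\<And>F. F \<in> fock_space \<Longrightarrow> fock_weight_fun F summable_on \<Lambda> \<and>
        A * fock_norm2 F \<le> (\<Sum>\<^sub>\<infinity>w\<in>\<Lambda>. fock_weight_fun F w) \<and>
        (\<Sum>\<^sub>\<infinity>w\<in>\<Lambda>. fock_weight_fun F w) \<le> B * fock_norm2 F"
    and inter: "interpolating_set \<Lambda>"
    unfolding sampling_set_def by blast

  \<comment> \<open>The lower sampling bound in the form used below: a constant \<open>q\<close>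
    strictly smaller than \<open>A\<close> leaves only the zero function.\<close>
  have zero: "F z = 0" if F: "F \<in> fock_space" and small: "(\<Sum>\<^sub>\<infinity>w\<in>\<Lambda>. fock_weight_fun F w) \<le> q * fock_norm2 F"
    and q: "q < A" for F :: "complex ^ 'n \<Rightarrow> complex" and q z
  proof -
    have "A * fock_norm2 F \<le> q * fock_norm2 F"
      using samp[OF F] small by linarith
    then have "fock_norm2 F = 0"
      using q fock_norm2_nonneg[of F] mult_strict_right_mono[OF q, of "fock_norm2 F"] by linarith
    with F show ?thesis
      by (rule fock_norm2_eq_0_imp)
  qed
  have upper: "(\<Sum>w\<in>S. fock_weight_fun F w) \<le> B * fock_norm2 F"
    if F: "F \<in> fock_space" and S: "finite S" "S \<subseteq> \<Lambda>" for F S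
  proof -
    have "(\<Sum>w\<in>S. fock_weight_fun F w) \<le> (\<Sum>\<^sub>\<infinity>w\<in>\<Lambda>. fock_weight_fun F w)"
      using samp[OF F] S by (intro finite_sum_le_infsum) (auto simp: fock_weight_fun_nonneg)
    then show ?thesis
      using samp[OF F] by linarith
  qed

  \<comment> \<open>Over an empty set the constant function \<open>1\<close> would have sum zero and
    hence vanish.\<close>
  have "\<Lambda> \<noteq> {}"
    using zero[OF one_in_fock_space, of 0] A by auto
  then obtain p where p: "p \<in> \<Lambda>"
    by blast
  have "(\<lambda>w. (cmod (of_bool (w = p) :: complex))\<^sup>2) summable_on \<Lambda>"
    by (rule summable_on_cong_neutral[THEN iffD1, OF _ _ _ summable_on_finite[of "{p}"]]) (use p in auto)
  with inter[unfolded interpolating_set_def, rule_format, of "\<lambda>w. of_bool (w = p)"]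
  obtain F where F: "F \<in> fock_space"
    and F_interp: "\<And>w. w \<in> \<Lambda> \<Longrightarrow> F w * exp (- pi * (norm w)\<^sup>2 / 2) = of_bool (w = p)"
    by blast
  then have E: "entire_Cd F"
    by (simp add: fock_space_def)
  have Fp: "F p \<noteq> 0"
    using F_interp[OF p] by auto
  have F0: "F w = 0" if "w \<in> \<Lambda>" "w \<noteq> p" for w
    using F_interp[OF that(1)] that(2) by auto

  obtain k :: 'n where True by blast
  \<comment> \<open>\<open>F\<close> vanishes on the rest of \<open>\<Lambda>\<close>, and the
    linear factor, in an arbitrary coordinate \<open>k\<close>, adds a zero at
    \<open>p\<close>.\<close>
  define H where "H z = (z $ k - p $ k) * F z" for z
  have H: "entire_Cd H"
    unfolding entire_Cd_def
  proof (intro allI exI conjI)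
    fix z
    have "((\<lambda>z. z $ k - p $ k) has_derivative (\<lambda>v. v $ k - 0)) (at z)"
      by (intro has_derivative_diff has_derivative_const bounded_linear_imp_has_derivative bounded_linear_vec_nth)
    from has_derivative_mult[OF this entire_Cd_has_derivative[OF E]]
    show "(H has_derivative (\<lambda>v. (z $ k - p $ k) * frechet_derivative F (at z) v + (v $ k - 0) * F z)) (at z)"
      unfolding H_def[abs_def] .
    show "(z $ k - p $ k) * frechet_derivative F (at z) (c *s v) + ((c *s v) $ k - 0) * F z =
        c * ((z $ k - p $ k) * frechet_derivative F (at z) v + (v $ k - 0) * F z)" for c v
      by (simp add: entire_Cd_derivative_linear[OF E] algebra_simps)
  qed
  have H0: "H w = 0" if "w \<in> \<Lambda>" for w
    using F0[OF that] by (cases "w = p") (auto simp: H_def)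
  have H_bound: "(cmod (H z))\<^sup>2 \<le> 2 * (1 + (norm p)\<^sup>2) * (1 + (norm z)\<^sup>2) * (cmod (F z))\<^sup>2" for z
  proof -
    have "cmod (z $ k - p $ k) \<le> norm z + norm p"
      by (rule order_trans[OF norm_triangle_ineq4]) (intro add_mono Finite_Cartesian_Product.norm_nth_le)
    then have "(cmod (z $ k - p $ k))\<^sup>2 \<le> (norm z + norm p)\<^sup>2"
      by (intro power_mono) auto
    also have "\<dots> \<le> 2 * (norm z)\<^sup>2 + 2 * (norm p)\<^sup>2"
      using zero_le_power2[of "norm z - norm p"] by (simp add: power2_eq_square algebra_simps)
    also have "\<dots> \<le> 2 * (1 + (norm p)\<^sup>2) * (1 + (norm z)\<^sup>2)"
      by (simp add: algebra_simps)
    finally show ?thesis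
      by (simp add: H_def norm_mult power_mult_distrib mult_right_mono)
  qed

  \<comment> \<open>The first condition puts the radial mean into the Fock space; the last makes the
    final constant smaller than \<open>A\<close>.\<close>
  obtain N :: nat where N: "DIM(complex ^ 'n) \<le> 2 * (N - 1)" "N > 0" "CARD('n) * (exp pi * B) / A < N"
  proof -
    obtain m :: nat where "CARD('n) * (exp pi * B) / A < m"
      using reals_Archimedean2 by blast
    then show ?thesis
      by (intro that[of "m + DIM(complex ^ 'n) + 1"]) auto
  qed
  define G where "G = radial_mean N H"
  have G: "G \<in> fock_space"
    unfolding G_def using H F H_bound N(1) by (rule radial_mean_in_fock_space)
  then have EG: "entire_Cd G"
    by (simp add: fock_space_def)
  define D where "D j w = frechet_derivative G (at w) (axis j 1) - of_real pi * cnj (w $ j) * G w" for j w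

  have pointwise: "fock_weight_fun G w \<le> 1 / N * (\<Sum>j\<in>UNIV. (cmod (D j w))\<^sup>2 * exp (- pi * (norm w)\<^sup>2))"
    if "w \<in> \<Lambda>" for w
  proof -
    have "frechet_derivative G (at w) w = (\<Sum>j\<in>UNIV. w $ j * frechet_derivative G (at w) (axis j 1))"
    proof -
      have "linear (frechet_derivative G (at w))"
        using entire_Cd_has_derivative[OF EG] by (rule has_derivative_linear)
      then have "frechet_derivative G (at w) (\<Sum>j\<in>UNIV. w $ j *s axis j 1) =
          (\<Sum>j\<in>UNIV. frechet_derivative G (at w) (w $ j *s axis j 1))"
        by (rule linear_sum)
      then show ?thesis
        by (simp add: basis_expansion entire_Cd_derivative_linear[OF EG])
    qed
    \<comment> \<open>Passing from partial to covariant derivatives produces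
      \<open>pi * (norm w)\<^sup>2 * G w\<close>, which the Euler identity with
      \<open>H w = 0\<close> adds to \<open>N * G w\<close> with the same sign.\<close>
    also have "\<dots> = (\<Sum>j\<in>UNIV. w $ j * D j w) + of_real pi * (\<Sum>j\<in>UNIV. w $ j * cnj (w $ j)) * G w"
      by (simp add: D_def sum_subtractf sum_distrib_left sum_distrib_right algebra_simps)
    also have "(\<Sum>j\<in>UNIV. w $ j * cnj (w $ j)) = of_real ((norm w)\<^sup>2)"
      by (simp add: norm_vec_def L2_set_def sum_nonneg complex_norm_square flip: of_real_power)
    finally have "frechet_derivative G (at w) w =
        (\<Sum>j\<in>UNIV. w $ j * D j w) + of_real (pi * (norm w)\<^sup>2) * G w"
      by simp
    with radial_mean_euler[OF H N(2), of w]
    have "of_real (N + pi * (norm w)\<^sup>2) * G w = - (\<Sum>j\<in>UNIV. w $ j * D j w)"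
      by (simp add: H0[OF that] G_def[symmetric] algebra_simps eq_neg_iff_add_eq_0)
    then have "cmod (of_real (N + pi * (norm w)\<^sup>2) * G w) = cmod (\<Sum>j\<in>UNIV. w $ j * D j w)"
      by (simp only: norm_minus_cancel)
    then have "(N + pi * (norm w)\<^sup>2) * cmod (G w) = cmod (\<Sum>j\<in>UNIV. w $ j * D j w)"
      by (simp only: norm_mult norm_of_real) simp
    also have "\<dots> \<le> (\<Sum>j\<in>UNIV. \<bar>cmod (w $ j)\<bar> * \<bar>cmod (D j w)\<bar>)"
      by (rule order_trans[OF norm_sum]) (simp add: norm_mult)
    also have "\<dots> \<le> norm w * L2_set (\<lambda>j. cmod (D j w)) UNIV"
      unfolding norm_vec_def by (rule L2_set_mult_ineq)
    finally have "((N + pi * (norm w)\<^sup>2) * cmod (G w))\<^sup>2 \<le> (norm w * L2_set (\<lambda>j. cmod (D j w)) UNIV)\<^sup>2"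
      by (intro power_mono) auto
    then have "(N + pi * (norm w)\<^sup>2)\<^sup>2 * (cmod (G w))\<^sup>2 \<le> (norm w)\<^sup>2 * (\<Sum>j\<in>UNIV. (cmod (D j w))\<^sup>2)"
      by (simp add: power_mult_distrib L2_set_def sum_nonneg)
    \<comment> \<open>The cross term of the square already dominates. It turns the Cauchy--Schwarz
      bound into a gain \<open>1 / N\<close> uniform in \<open>w\<close>.\<close>
    moreover have "N * (norm w)\<^sup>2 \<le> (N + pi * (norm w)\<^sup>2)\<^sup>2"
    proof -
      have "N * (norm w)\<^sup>2 \<le> N * (pi * (norm w)\<^sup>2)"
        using pi_gt3 by (intro mult_left_mono mult_right_mono[of 1 pi, simplified]) auto
      also have "\<dots> \<le> (N + pi * (norm w)\<^sup>2)\<^sup>2"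
        by (simp add: power2_sum)
      finally show ?thesis .
    qed
    ultimately have le: "(N + pi * (norm w)\<^sup>2)\<^sup>2 * (N * (cmod (G w))\<^sup>2) \<le>
        (N + pi * (norm w)\<^sup>2)\<^sup>2 * (\<Sum>j\<in>UNIV. (cmod (D j w))\<^sup>2)"
      by (smt (verit) mult.assoc mult.commute mult_left_mono mult_right_mono of_nat_0_le_iff sum_nonneg zero_le_power2)
    have "N + pi * (norm w)\<^sup>2 > 0"
      using N(2) by (intro add_pos_nonneg) auto
    with le have "N * (cmod (G w))\<^sup>2 \<le> (\<Sum>j\<in>UNIV. (cmod (D j w))\<^sup>2)"
      by (simp add: mult_le_cancel_left)
    then have "N * (cmod (G w))\<^sup>2 * exp (- pi * (norm w)\<^sup>2) \<le> (\<Sum>j\<in>UNIV. (cmod (D j w))\<^sup>2) * exp (- pi * (norm w)\<^sup>2)"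
      by (rule mult_right_mono) simp
    then have "fock_weight_fun G w * N \<le> (\<Sum>j\<in>UNIV. (cmod (D j w))\<^sup>2 * exp (- pi * (norm w)\<^sup>2))"
      unfolding fock_weight_fun_def sum_distrib_right by (simp only: mult_ac)
    then show ?thesis
      using N(2) by (simp add: pos_le_divide_eq)
  qed

  have finite_bound: "(\<Sum>w\<in>S. fock_weight_fun G w) \<le> CARD('n) * (exp pi * B) / N * fock_norm2 G"
    if S: "finite S" "S \<subseteq> \<Lambda>" for S
  proof -
    have "(\<Sum>w\<in>S. fock_weight_fun G w) \<le>
        (\<Sum>w\<in>S. 1 / N * (\<Sum>j\<in>UNIV. (cmod (D j w))\<^sup>2 * exp (- pi * (norm w)\<^sup>2)))"
      using S by (intro sum_mono pointwise) auto
    also have "\<dots> = 1 / N * (\<Sum>j\<in>UNIV. \<Sum>w\<in>S. (cmod (D j w))\<^sup>2 * exp (- pi * (norm w)\<^sup>2))"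
      by (subst sum.swap) (simp only: sum_distrib_left)
    also have "\<dots> \<le> 1 / N * (\<Sum>j\<in>(UNIV :: 'n set). exp pi * B * fock_norm2 G)"
      unfolding D_def using upper S
      by (intro mult_left_mono sum_mono covariant_derivative_upper_bound[OF G]) auto
    finally show ?thesis
      by simp
  qed
  have "G z = 0" for z
  proof (rule zero[OF G])
    show "(\<Sum>\<^sub>\<infinity>w\<in>\<Lambda>. fock_weight_fun G w) \<le> CARD('n) * (exp pi * B) / N * fock_norm2 G"
      using samp[OF G] finite_bound by (intro infsum_le_finite_sums) auto
    show "CARD('n) * (exp pi * B) / N < A"
      using N A by (simp add: field_simps)
  qed
  then have "G = (\<lambda>_. 0)"
    by auto
  \<comment> \<open>The Euler identity recovers \<open>H\<close> from its radial mean.\<close>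
  then have "H z = 0" for z
    using radial_mean_euler[OF H N(2), of z] N(2) by (simp add: G_def)
  then have F_off: "F z = 0" if "z $ k \<noteq> p $ k" for z
    using that unfolding H_def by (metis eq_iff_diff_eq_0 mult_eq_0_iff)
  \<comment> \<open>\<open>F\<close> is zero off the hyperplane through \<open>p\<close> where
    coordinate \<open>k\<close> is constant. Approaching \<open>p\<close> transversally along
    \<open>axis k 1\<close> gives \<open>F p = 0\<close> by continuity.\<close>
  have "((\<lambda>c. F (p + c *s axis k 1)) \<longlongrightarrow> F (p + 0 *s axis k 1)) (at 0)"
    using entire_Cd_has_field_derivative_line[OF E, of p "axis k 1" 0] DERIV_isCont isCont_def by fast
  moreover have "eventually (\<lambda>c. F (p + c *s axis k 1) = 0) (at 0)"
    unfolding eventually_at_filter by (intro always_eventually allI impI F_off) (simp add: axis_def)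
  ultimately have "((\<lambda>c::complex. 0) \<longlongrightarrow> F (p + 0 *s axis k 1)) (at 0)"
    by (rule Lim_transform_eventually)
  then have "F p = 0"
    by (simp add: tendsto_const_iff)
  with Fp show False
    by contradiction
qed

end
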